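(* Let $S$ be a semigroup. For $i=1,2$ let $a_i,b_i,c_i\in S$ and suppose that $a_i$ is $(b_i,c_i)$-invertible with $(b_i,c_i)$-inverse $x_i$. If at least one of the following holds: (i) $x_1a_1=a_1x_1$ and $c_1=c_2$; (ii) $x_2a_2=a_2x_2$ and $b_1=b_2$; (iii) $x_1a_1=a_2x_2$; then $a_1a_2$ is $(b_2,c_1)$-invertible and its $(b_2,c_1)$-inverse is $x_2x_1$.
   Context: For $a,b,c\in S$, an element $x\in S$ is a $(b,c)$-inverse of $a$ if $xab=b$, $cax=c$, $x\in bSx$, and $x\in xSc$ (equivalently $xab=b$, $cax=c$, $x\in bS$, $x\in Sc$); such $x$ is unique when it exists, and $a$ is then called $(b,c)$-invertible. *)

theory Defs
  imports Main
begin

text \<open>The ambient semigroup \<open>S\<close> is the carrier type of class \<open>semigroup_mult\<close>. No identity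
  is adjoined: the multipliers \<open>s\<close> in \<open>x \<in> b S x\<close> and \<open>x \<in> x S c\<close> range over \<open>S\<close> itself.\<close>

definition is_bc_inverse :: "'a::semigroup_mult \<Rightarrow> 'a \<Rightarrow> 'a \<Rightarrow> 'a \<Rightarrow> bool" where
  "is_bc_inverse b c a x \<longleftrightarrow>
     x * a * b = b \<and> c * a * x = c \<and>
     x \<in> {b * s * x | s. s \<in> UNIV} \<and> x \<in> {x * s * c | s. s \<in> UNIV}"

definition bc_invertible :: "'a::semigroup_mult \<Rightarrow> 'a \<Rightarrow> 'a \<Rightarrow> bool" where
  "bc_invertible b c a \<longleftrightarrow> (\<exists>x. is_bc_inverse b c a x)"

lemma is_bc_inverse_iff:
  fixes a b c x :: "'a::semigroup_mult"
  shows "is_bc_inverse b c a x \<longleftrightarrow>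
    x * a * b = b \<and> c * a * x = c \<and> (\<exists>s. x = b * s) \<and> (\<exists>t. x = t * c)"
proof
  assume "is_bc_inverse b c a x"
  then show "x * a * b = b \<and> c * a * x = c \<and> (\<exists>s. x = b * s) \<and> (\<exists>t. x = t * c)"
    unfolding is_bc_inverse_def mem_Collect_eq by (metis mult.assoc)
next
  assume *: "x * a * b = b \<and> c * a * x = c \<and> (\<exists>s. x = b * s) \<and> (\<exists>t. x = t * c)"
  then obtain s t where s: "x = b * s" and t: "x = t * c" by blast
  have xax: "x * a * x = x"
    using * s by (metis mult.assoc)
  have "x = b * (s * a) * x" "x = x * (a * t) * c"
    using xax s t by (metis mult.assoc)+
  with * show "is_bc_inverse b c a x"
    unfolding is_bc_inverse_def by blast
qed

lemma is_bc_inverse_unique: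
  fixes a b c x y :: "'a::semigroup_mult"
  assumes "is_bc_inverse b c a x" and "is_bc_inverse b c a y"
  shows "x = y"
proof -
  from assms obtain t s where t: "x = t * c" and s: "y = b * s"
    unfolding is_bc_inverse_iff by blast
  have "c * a * y = c" "x * a * b = b"
    using assms unfolding is_bc_inverse_iff by auto
  then have "x = x * a * y" "y = x * a * y"
    using s t by (metis mult.assoc)+
  then show ?thesis by simp
qed

end

theory Submission
  imports Defs
begin

text \<open>
  Since \<open>x2 \<in> b2 S\<close> and \<open>x1 \<in> S c1\<close>, the product \<open>x2 * x1\<close> lies in \<open>b2 S\<close> and in \<open>S c1\<close>, so
  what has to be proved are the equations \<open>x2 x1 a1 a2 b2 = b2\<close> and \<open>c1 a1 a2 x2 x1 = c1\<close>.
  Each of them has an idempotent in its middle, \<open>x1 a1\<close> in the first and \<open>a2 x2\<close>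
  in the second, and holds as soon as this idempotent is absorbed by one of its neighbours, because
  \<open>x2 a2 b2 = b2\<close> and \<open>c1 a1 x1 = c1\<close>.

  \<^item> If \<open>x1 a1 = a1 x1\<close> and both inverses have the same \<open>c\<close>, then right multiplication by
    \<open>a1 x1\<close> fixes \<open>S c\<close>, so \<open>x1 a1 = a1 x1\<close> is absorbed by \<open>x2 \<in> S c\<close>. Commutation also puts
    \<open>c a1\<close> into \<open>S c\<close>, where right multiplication by \<open>a2 x2\<close> is the identity, so \<open>a2 x2\<close> is
    absorbed by \<open>c a1\<close>.
  \<^item> The case \<open>x2 a2 = a2 x2\<close> with the same \<open>b\<close> is the left-right mirror image: \<open>x1 \<in> b S\<close> absorbs
    \<open>a2 x2 = x2 a2\<close>, and \<open>a2 b \<in> b S\<close> absorbs \<open>x1 a1\<close>.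
  \<^item> If \<open>x1 a1 = a2 x2\<close>, then \<open>a2 x2\<close> in place of \<open>x1 a1\<close> is absorbed by \<open>x2\<close>, and \<open>x1 a1\<close> in place
    of \<open>a2 x2\<close> is absorbed by \<open>x1\<close>, because \<open>x2 a2 x2 = x2\<close> and \<open>x1 a1 x1 = x1\<close>.
\<close>

lemma is_bc_inverse_outer:
  assumes "is_bc_inverse b c a x"
  shows "x * a * x = x"
  using assms unfolding is_bc_inverse_iff by (metis mult.assoc)

lemma right_fixed_of_left_multiple:
  fixes a b c x y :: "'a::semigroup_mult"
  assumes "is_bc_inverse b c a x" and "y = t * c"
  shows "y * (a * x) = y"
  using assms unfolding is_bc_inverse_iff by (metis mult.assoc)

lemma left_fixed_of_right_multiple:
  fixes a b c x y :: "'a::semigroup_mult"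
  assumes "is_bc_inverse b c a x" and "y = b * s"
  shows "x * a * y = y"
  using assms unfolding is_bc_inverse_iff by (metis mult.assoc)

text \<open>Commutation with \<open>x\<close> lets \<open>a\<close> pass through the one-sided ideals generated by \<open>c\<close> and \<open>b\<close>:
  it moves the factor \<open>x\<close> of \<open>c a = c a x a\<close> to the right end, where \<open>x \<in> S c\<close> takes over, and that
  of \<open>a b = a x a b\<close> to the left end, where \<open>x \<in> b S\<close> does.\<close>

lemma commuting_left_ideal:
  fixes a b c x :: "'a::semigroup_mult"
  assumes x: "is_bc_inverse b c a x" and comm: "x * a = a * x"
  obtains u where "c * a = u * c"
proof -
  obtain t where t: "x = t * c"
    using x unfolding is_bc_inverse_iff by blast
  have "c * a = c * a * x * a"
    using x unfolding is_bc_inverse_iff by simp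
  also have "\<dots> = c * a * a * x"
    using comm by (simp add: mult.assoc)
  also have "\<dots> = (c * a * a * t) * c"
    by (simp only: t mult.assoc)
  finally show thesis by (rule that)
qed

lemma commuting_right_ideal:
  fixes a b c x :: "'a::semigroup_mult"
  assumes x: "is_bc_inverse b c a x" and comm: "x * a = a * x"
  obtains u where "a * b = b * u"
proof -
  obtain s where s: "x = b * s"
    using x unfolding is_bc_inverse_iff by blast
  have "a * b = a * (x * a * b)"
    using x unfolding is_bc_inverse_iff by simp
  also have "\<dots> = (a * x) * (a * b)"
    by (simp only: mult.assoc)
  also have "\<dots> = x * a * (a * b)"
    by (simp only: comm)
  also have "\<dots> = b * (s * a * a * b)"
    by (simp only: s mult.assoc)
  finally show thesis by (rule that)
qed

text \<open>The two one-sided ideal memberships of \<open>x2 * x1\<close> are inherited from its outer factors, which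
  reduces the reverse order law to its two equations. They are bracketed here around the
  idempotents \<open>x1 * a1\<close> and \<open>a2 * x2\<close>.\<close>

lemma reverse_order_law_iff:
  fixes a1 a2 b1 b2 c1 c2 x1 x2 :: "'a::semigroup_mult"
  assumes "is_bc_inverse b1 c1 a1 x1" and "is_bc_inverse b2 c2 a2 x2"
  shows "is_bc_inverse b2 c1 (a1 * a2) (x2 * x1) \<longleftrightarrow>
    x2 * (x1 * a1) * (a2 * b2) = b2 \<and> c1 * a1 * (a2 * x2) * x1 = c1"
proof -
  obtain s t where "x2 = b2 * s" "x1 = t * c1"
    using assms unfolding is_bc_inverse_iff by blast
  then have "x2 * x1 = b2 * (s * x1)" "x2 * x1 = (x2 * t) * c1"
    by (simp_all only: mult.assoc)
  then have "\<exists>s. x2 * x1 = b2 * s" "\<exists>t. x2 * x1 = t * c1"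
    by blast+
  then show ?thesis
    unfolding is_bc_inverse_iff by (simp add: mult.assoc)
qed

theorem theorem4p6:
  fixes a1 a2 b1 b2 c1 c2 x1 x2 :: "'a::semigroup_mult"
  assumes "is_bc_inverse b1 c1 a1 x1"
    and "is_bc_inverse b2 c2 a2 x2"
    and "(x1 * a1 = a1 * x1 \<and> c1 = c2) \<or>
         (x2 * a2 = a2 * x2 \<and> b1 = b2) \<or>
         x1 * a1 = a2 * x2"
  shows "bc_invertible b2 c1 (a1 * a2) \<and> is_bc_inverse b2 c1 (a1 * a2) (x2 * x1)"
proof -
  note inv1 = assms(1) and inv2 = assms(2)
  have b2: "x2 * (a2 * b2) = b2" and c1: "c1 * a1 * x1 = c1"
    using inv1 inv2 unfolding is_bc_inverse_iff by (simp_all add: mult.assoc)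
  have "x2 * (x1 * a1) * (a2 * b2) = b2 \<and> c1 * a1 * (a2 * x2) * x1 = c1"
    using assms(3)
  proof (elim disjE conjE)
    assume comm: "x1 * a1 = a1 * x1" and c: "c1 = c2"
    obtain t where "x2 = t * c1"
      using inv2 c unfolding is_bc_inverse_iff by blast
    then have "x2 * (x1 * a1) = x2"
      using right_fixed_of_left_multiple[OF inv1] comm by simp
    moreover obtain u where "c1 * a1 = u * c2"
      using commuting_left_ideal[OF inv1 comm] c by blast
    then have "c1 * a1 * (a2 * x2) = c1 * a1"
      by (rule right_fixed_of_left_multiple[OF inv2])
    ultimately show ?thesis
      using b2 c1 by simp
  next
    assume comm: "x2 * a2 = a2 * x2" and b: "b1 = b2"
    obtain s where "x1 = b2 * s"
      using inv1 b unfolding is_bc_inverse_iff by blast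
    then have "a2 * x2 * x1 = x1"
      using left_fixed_of_right_multiple[OF inv2] comm by simp
    moreover obtain u where "a2 * b2 = b1 * u"
      using commuting_right_ideal[OF inv2 comm] b by blast
    then have "x1 * a1 * (a2 * b2) = a2 * b2"
      by (rule left_fixed_of_right_multiple[OF inv1])
    ultimately show ?thesis
      using b2 c1 by (simp add: mult.assoc)
  next
    assume eq: "x1 * a1 = a2 * x2"
    have "x2 * (x1 * a1) = x2"
      using is_bc_inverse_outer[OF inv2] eq by (simp add: mult.assoc)
    moreover have "a2 * x2 * x1 = x1"
      using is_bc_inverse_outer[OF inv1] eq by simp
    ultimately show ?thesis
      using b2 c1 by (simp add: mult.assoc)
  qed
  then have "is_bc_inverse b2 c1 (a1 * a2) (x2 * x1)"
    using reverse_order_law_iff[OF inv1 inv2] by simp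
  then show ?thesis
    unfolding bc_invertible_def by blast
qed

end
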